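(* Let $d\ge 1$ and $s\ge 1$ be integers. For every $f\in\mathcal{F}^{d,s}_{\text{ST}}$, we have $V^{d,s}_{\infty-\text{XGB}}(f)=V^{d,s}_{\text{XGB}}(f)$.
   Context: Regression trees. A regression tree with right-continuous splits is a function on $\mathbb{R}^d$ given by a finite binary tree in which each internal node carries a split of the form $x_j\ge t$ versus $x_j<t$ (for some $j\in[d]:=\{1,\dots,d\}$, $t\in\mathbb{R}$) and each leaf carries a real weight; its value at $\mathbf{x}$ is the weight of the leaf reached by $\mathbf{x}$. The depth is the maximum number of splits along any root-to-leaf path. A constant function is also allowed as a tree (a constant regression tree, of depth $0$). $\mathcal{F}^{d,s}_{\text{ST}}$ is the class of all finite sums $\sum_{k=1}^K f_k$ ($K\ge 1$ arbitrary) where each $f_k$ is a regression tree with right-continuous splits and depth at most $s$. XGBoost penalty. For $f\in\mathcal{F}^{d,s}_{\text{ST}}$, $V^{d,s}_{\text{XGB}}(f)=\inf\{\sum_k\|\mathbf{w}_k\|_1\}$, where the infimum is over all representations of $f$ as a finite sum of regression trees with right-continuous splits and depth at most $s$, $\mathbf{w}_k$ is the vector of leaf weights of the $k$-th tree, $\|\cdot\|_1$ is the $\ell^1$ norm, and by convention $\|\mathbf{w}_k\|_1=0$ if the $k$-th tree is a constant tree. Extended class. For (not necessarily disjoint) $L,U\subseteq[d]$ with $0<|L|+|U|\le s$ and threshold vectors $\mathbf{l}=(l_j,j\in L)$, $\mathbf{u}=(u_j,j\in U)$, let $b^{L,U}_{\mathbf{l},\mathbf{u}}(x_1,\dots,x_d)=\prod_{j\in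 L}\mathbf{1}(x_j\ge l_j)\cdot\prod_{j\in U}\mathbf{1}(x_j<u_j)$. For $c\in\mathbb{R}$ and finite signed Borel measures $\nu_{L,U}$ on $\mathbb{R}^{|L|+|U|}$, let $$f^{d,s}_{c,\{\nu_{L,U}\}}(\mathbf{x})=c+\sum_{0<|L|+|U|\le s}\int_{\mathbb{R}^{|L|+|U|}}b^{L,U}_{\mathbf{l},\mathbf{u}}(\mathbf{x})\,d\nu_{L,U}(\mathbf{l},\mathbf{u}).$$ $\mathcal{F}^{d,s}_{\infty-\text{ST}}$ is the set of all such functions (it contains $\mathcal{F}^{d,s}_{\text{ST}}$). For $f\in\mathcal{F}^{d,s}_{\infty-\text{ST}}$, $$V^{d,s}_{\infty-\text{XGB}}(f)=\inf\Big\{\sum_{0<|L|+|U|\le s}\|\nu_{L,U}\|_{\text{TV}}: f^{d,s}_{c,\{\nu_{L,U}\}}\equiv f\Big\},$$ the infimum over all such representations of $f$, where $\|\nu\|_{\text{TV}}=|\nu|(\mathbb{R}^{|L|+|U|})$ is the total variation. *)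

theory Defs
  imports "HOL-Analysis.Analysis"
begin

section \<open>Regression trees\<close>

text \<open>The dimension is the cardinality of the finite index type \<open>'d\<close>. In \<open>Split j t A B\<close>, points
  with \<open>x $ j \<ge> t\<close> continue in \<open>A\<close> and points with \<open>x $ j < t\<close> in \<open>B\<close>.\<close>

datatype 'd rtree = Leaf real | Split 'd real "'d rtree" "'d rtree"

fun tree_fun :: "'d::finite rtree \<Rightarrow> real ^ 'd \<Rightarrow> real" where
  "tree_fun (Leaf w) x = w"
| "tree_fun (Split j t A B) x = (if x $ j \<ge> t then tree_fun A x else tree_fun B x)"

fun tree_depth :: "'d rtree \<Rightarrow> nat" where
  "tree_depth (Leaf w) = 0"
| "tree_depth (Split j t A B) = Suc (max (tree_depth A) (tree_depth B))"

fun leaf_weights :: "'d rtree \<Rightarrow> real list" where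
  "leaf_weights (Leaf w) = [w]"
| "leaf_weights (Split j t A B) = leaf_weights A @ leaf_weights B"

text \<open>A constant tree, that is a tree without splits, is not penalized.\<close>

definition tree_penalty :: "'d rtree \<Rightarrow> real" where
  "tree_penalty T = (case T of Leaf w \<Rightarrow> 0 | Split j t A B \<Rightarrow> (\<Sum>w\<leftarrow>leaf_weights T. \<bar>w\<bar>))"

definition tree_representations ::
    "nat \<Rightarrow> (real ^ 'd::finite \<Rightarrow> real) \<Rightarrow> 'd rtree list set" where
  "tree_representations s f =
     {Ts. Ts \<noteq> [] \<and> (\<forall>T\<in>set Ts. tree_depth T \<le> s) \<and> (\<forall>x. f x = (\<Sum>T\<leftarrow>Ts. tree_fun T x))}"

definition F_ST :: "nat \<Rightarrow> (real ^ 'd::finite \<Rightarrow> real) set" where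
  "F_ST s = {f. tree_representations s f \<noteq> {}}"

definition V_XGB :: "nat \<Rightarrow> (real ^ 'd::finite \<Rightarrow> real) \<Rightarrow> ennreal" where
  "V_XGB s f = (INF Ts\<in>tree_representations s f. ennreal (\<Sum>T\<leftarrow>Ts. tree_penalty T))"


section \<open>Finite signed measures\<close>

text \<open>A finite signed measure on the measurable space underlying \<open>M\<close> is a real-valued countably
  additive function on \<open>sets M\<close>; the measure carried by \<open>M\<close> itself is irrelevant.\<close>

definition signed_measure :: "'a measure \<Rightarrow> ('a set \<Rightarrow> real) \<Rightarrow> bool" where
  "signed_measure M \<nu> \<longleftrightarrow> \<nu> {} = 0 \<and>
     (\<forall>A :: nat \<Rightarrow> 'a set. range A \<subseteq> sets M \<longrightarrow> disjoint_family A \<longrightarrow>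
        (\<lambda>i. \<nu> (A i)) sums \<nu> (\<Union>i. A i))"

definition variation :: "'a measure \<Rightarrow> ('a set \<Rightarrow> real) \<Rightarrow> 'a set \<Rightarrow> ennreal" where
  "variation M \<nu> E =
     (SUP A\<in>{A :: nat \<Rightarrow> 'a set. range A \<subseteq> sets M \<and> disjoint_family A \<and> (\<Union>i. A i) = E}.
        \<Sum>i. ennreal \<bar>\<nu> (A i)\<bar>)"

definition tv_norm :: "'a measure \<Rightarrow> ('a set \<Rightarrow> real) \<Rightarrow> ennreal" where
  "tv_norm M \<nu> = variation M \<nu> (space M)"

text \<open>The parts of the Jordan decomposition, \<open>\<nu>\<^sup>+ E = sup {\<nu> B | B \<subseteq> E}\<close> and \<open>\<nu>\<^sup>- = (- \<nu>)\<^sup>+\<close>. Negative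
  values of \<open>\<nu> B\<close> are truncated to 0 by \<^const>\<open>ennreal\<close>, which is harmless since \<open>B = {}\<close> is allowed.
  For a finite signed measure \<open>\<nu>\<close> these set functions are finite measures, so that
  \<^const>\<open>measure_of\<close> does not fall back to the zero measure.\<close>

definition pos_part :: "'a measure \<Rightarrow> ('a set \<Rightarrow> real) \<Rightarrow> 'a measure" where
  "pos_part M \<nu> =
     measure_of (space M) (sets M) (\<lambda>E. SUP B\<in>{B \<in> sets M. B \<subseteq> E}. ennreal (\<nu> B))"

definition neg_part :: "'a measure \<Rightarrow> ('a set \<Rightarrow> real) \<Rightarrow> 'a measure" where
  "neg_part M \<nu> = pos_part M (\<lambda>B. - \<nu> B)"

definition signed_integral :: "'a measure \<Rightarrow> ('a set \<Rightarrow> real) \<Rightarrow> ('a \<Rightarrow> real) \<Rightarrow> real" where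
  "signed_integral M \<nu> g = (\<integral>z. g z \<partial>pos_part M \<nu>) - (\<integral>z. g z \<partial>neg_part M \<nu>)"


section \<open>The extended class\<close>

definition basis_fun ::
    "'d::finite set \<Rightarrow> 'd set \<Rightarrow> ('d \<Rightarrow> real) \<Rightarrow> ('d \<Rightarrow> real) \<Rightarrow> real ^ 'd \<Rightarrow> real" where
  "basis_fun L U l u x =
     (\<Prod>j\<in>L. of_bool (x $ j \<ge> l j)) * (\<Prod>j\<in>U. of_bool (x $ j < u j))"

text \<open>The space of thresholds \<open>((l\<^sub>j)\<^sub>j\<^sub>\<in>\<^sub>L, (u\<^sub>j)\<^sub>j\<^sub>\<in>\<^sub>U)\<close>, a copy of Euclidean space of dimension
  \<open>card L + card U\<close>. As the index sets are finite, the product sigma-algebra is the Borel one.\<close>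

definition threshold_space ::
    "'d set \<Rightarrow> 'd set \<Rightarrow> (('d \<Rightarrow> real) \<times> ('d \<Rightarrow> real)) measure" where
  "threshold_space L U = (\<Pi>\<^sub>M j\<in>L. borel) \<Otimes>\<^sub>M (\<Pi>\<^sub>M j\<in>U. borel)"

definition index_pairs :: "nat \<Rightarrow> ('d::finite set \<times> 'd set) set" where
  "index_pairs s = {(L, U). 0 < card L + card U \<and> card L + card U \<le> s}"

type_synonym 'd measure_family =
  "'d set \<Rightarrow> 'd set \<Rightarrow> (('d \<Rightarrow> real) \<times> ('d \<Rightarrow> real)) set \<Rightarrow> real"

definition inf_fun ::
    "nat \<Rightarrow> real \<Rightarrow> 'd::finite measure_family \<Rightarrow> real ^ 'd \<Rightarrow> real" where
  "inf_fun s c \<nu> x = c + (\<Sum>(L, U)\<in>index_pairs s.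
     signed_integral (threshold_space L U) (\<nu> L U) (\<lambda>(l, u). basis_fun L U l u x))"

definition inf_representations ::
    "nat \<Rightarrow> (real ^ 'd::finite \<Rightarrow> real) \<Rightarrow> (real \<times> 'd measure_family) set" where
  "inf_representations s f =
     {(c, \<nu>). (\<forall>(L, U)\<in>index_pairs s. signed_measure (threshold_space L U) (\<nu> L U)) \<and>
              (\<forall>x. inf_fun s c \<nu> x = f x)}"

definition V_inf_XGB :: "nat \<Rightarrow> (real ^ 'd::finite \<Rightarrow> real) \<Rightarrow> ennreal" where
  "V_inf_XGB s f = (INF (c, \<nu>)\<in>inf_representations s f.
     \<Sum>(L, U)\<in>index_pairs s. tv_norm (threshold_space L U) (\<nu> L U))"

end

theory Submission imports Defs begin

text \<open>Every tree is a sum of leaf weights times basis functions, so replacing the basis functions by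
  point masses gives \<open>V_inf_XGB s f \<le> V_XGB s f\<close>. Conversely, let \<open>f\<close> be a finite sum of trees and
  let \<open>q\<close> round each coordinate down to the finite grid of all thresholds of these trees (with one
  extra grid point below them), so that \<open>f \<circ> q = f\<close>. In any representation of \<open>f\<close> by measures, replace
  \<open>x\<close> by \<open>q x\<close>. As \<open>q\<close> is monotone, right-continuous and takes finitely many values, the threshold
  spaces split into finitely many atoms on each of which \<open>b \<circ> q\<close> does not depend on the thresholds
  and is constantly 0 or 1 or a tree with a single leaf of weight 1 and all others 0. The integral thus
  becomes a finite sum of trees, weighted by the measures of the atoms, whose absolute values add up
  to at most the total variation. Only measures of finite \<^const>\<open>tv_norm\<close> matter, so the general
  theorem that a real-valued signed measure is bounded is not needed.\<close>

section \<open>Signed measures of finite total variation\<close>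

lemma signed_measure_Un:
  assumes "signed_measure M \<nu>" "A \<in> sets M" "B \<in> sets M" "A \<inter> B = {}"
  shows "\<nu> (A \<union> B) = \<nu> A + \<nu> B"
proof -
  have "range (binaryset A B) \<subseteq> sets M" "disjoint_family (binaryset A B)"
    using assms by (auto simp: range_binaryset_eq disjoint_family_on_def binaryset_def Int_commute)
  then have "(\<lambda>i. \<nu> (binaryset A B i)) sums \<nu> (A \<union> B)"
    using assms(1) unfolding signed_measure_def by (metis UN_binaryset_eq)
  moreover have "(\<lambda>i. \<nu> (binaryset A B i)) sums (\<nu> A + \<nu> B)"
    using assms(1) by (intro binaryset_sums) (auto simp: signed_measure_def)
  ultimately show ?thesis
    by (rule sums_unique2)
qed

lemma signed_measure_UN:
  assumes "signed_measure M \<nu>" "finite I" "\<And>i. i \<in> I \<Longrightarrow> A i \<in> sets M" "disjoint_family_on A I"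
  shows "\<nu> (\<Union>i\<in>I. A i) = (\<Sum>i\<in>I. \<nu> (A i))"
  using assms(2,3,4)
proof (induction I)
  case empty
  then show ?case using assms(1) by (simp add: signed_measure_def)
next
  case (insert i I)
  have "\<nu> (A i \<union> (\<Union>i\<in>I. A i)) = \<nu> (A i) + \<nu> (\<Union>i\<in>I. A i)"
    using insert by (intro signed_measure_Un[OF assms(1)])
      (auto simp: disjoint_family_on_def)
  moreover have "\<nu> (\<Union>i\<in>I. A i) = (\<Sum>i\<in>I. \<nu> (A i))"
    using insert by (auto simp: disjoint_family_on_def)
  ultimately show ?case using insert by simp
qed

lemma signed_measure_uminus:
  assumes "signed_measure M \<nu>"
  shows "signed_measure M (\<lambda>A. - \<nu> A)"
  using assms by (auto simp: signed_measure_def intro!: sums_minus)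

lemma signed_measure_add:
  assumes "signed_measure M \<nu>" "signed_measure M \<mu>"
  shows "signed_measure M (\<lambda>A. \<nu> A + \<mu> A)"
  using assms by (auto simp: signed_measure_def intro!: sums_add)

lemma tv_norm_uminus: "tv_norm M (\<lambda>A. - \<nu> A) = tv_norm M \<nu>"
  by (simp add: tv_norm_def variation_def)

lemma tv_norm_add_le: "tv_norm M (\<lambda>A. \<nu> A + \<mu> A) \<le> tv_norm M \<nu> + tv_norm M \<mu>"
  unfolding tv_norm_def variation_def
proof (rule SUP_least)
  fix A :: "nat \<Rightarrow> 'a set"
  let ?P = "{A :: nat \<Rightarrow> 'a set. range A \<subseteq> sets M \<and> disjoint_family A \<and> (\<Union>i. A i) = space M}"
  assume A: "A \<in> ?P"
  have "(\<Sum>i. ennreal \<bar>\<nu> (A i) + \<mu> (A i)\<bar>) \<le> (\<Sum>i. ennreal \<bar>\<nu> (A i)\<bar> + ennreal \<bar>\<mu> (A i)\<bar>)"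
    by (intro suminf_le) (auto simp flip: ennreal_plus)
  also have "\<dots> = (\<Sum>i. ennreal \<bar>\<nu> (A i)\<bar>) + (\<Sum>i. ennreal \<bar>\<mu> (A i)\<bar>)"
    by (rule suminf_add[symmetric]) auto
  also have "\<dots> \<le> (SUP A\<in>?P. \<Sum>i. ennreal \<bar>\<nu> (A i)\<bar>) + (SUP A\<in>?P. \<Sum>i. ennreal \<bar>\<mu> (A i)\<bar>)"
    using A by (intro add_mono SUP_upper) auto
  finally show "(\<Sum>i. ennreal \<bar>\<nu> (A i) + \<mu> (A i)\<bar>) \<le> \<dots>" .
qed

text \<open>The variation is a supremum over sequences that partition the whole space, so a finite
  disjoint family must first be completed to such a sequence.\<close>

lemma sum_abs_le_tv_norm:
  assumes "finite I" "\<And>i. i \<in> I \<Longrightarrow> A i \<in> sets M" "disjoint_family_on A I"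
  shows "(\<Sum>i\<in>I. ennreal \<bar>\<nu> (A i)\<bar>) \<le> tv_norm M \<nu>"
proof -
  obtain h where h: "bij_betw h {0..<card I} I"
    using ex_bij_betw_nat_finite[OF assms(1)] by blast
  let ?n = "card I"
  let ?R = "space M - (\<Union>i\<in>I. A i)"
  \<comment> \<open>Enumerate the family, append the rest of the space at position
    \<open>?n\<close>, and pad with empty sets. Dropping the tail of the series only decreases
    it.\<close>
  define A' where "A' = (\<lambda>k. if k < ?n then A (h k) else if k = ?n then ?R else {})"
  have hI: "h k \<in> I" if "k < ?n" for k
    using h that by (auto simp: bij_betw_def)
  have hinj: "h k = h k' \<longleftrightarrow> k = k'" if "k < ?n" "k' < ?n" for k k'
    using h that by (auto simp: bij_betw_def inj_on_def)
  have surj: "\<exists>k<?n. h k = i" if "i \<in> I" for i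
    using h that unfolding bij_betw_def by (metis atLeastLessThan_iff imageE)
  have "range A' \<subseteq> sets M"
    using assms hI by (auto simp: A'_def)
  moreover have "disjoint_family A'"
    unfolding disjoint_family_on_def
  proof (intro ballI impI)
    fix k k' :: nat assume "k \<noteq> k'"
    then show "A' k \<inter> A' k' = {}"
      using assms(3) hI hinj[of k k'] unfolding A'_def disjoint_family_on_def
      by (cases "k < ?n"; cases "k' < ?n") (auto split: if_splits dest!: hI)
  qed
  moreover have "(\<Union>i. A' i) = space M"
  proof
    show "(\<Union>i. A' i) \<subseteq> space M"
      using calculation(1) sets.sets_into_space by blast
    show "space M \<subseteq> (\<Union>i. A' i)"
    proof
      fix x assume x: "x \<in> space M"
      show "x \<in> (\<Union>i. A' i)"
      proof (cases "x \<in> (\<Union>i\<in>I. A i)")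
        case True
        then obtain i where "i \<in> I" "x \<in> A i" by blast
        with surj obtain k where "k < ?n" "x \<in> A (h k)" by blast
        then have "x \<in> A' k" by (simp add: A'_def)
        then show ?thesis by blast
      next
        case False
        with x have "x \<in> A' ?n" by (simp add: A'_def)
        then show ?thesis by blast
      qed
    qed
  qed
  ultimately have "(\<Sum>i. ennreal \<bar>\<nu> (A' i)\<bar>) \<le> tv_norm M \<nu>"
    unfolding tv_norm_def variation_def by (intro SUP_upper) simp
  moreover have "(\<Sum>i\<in>{0..<?n}. ennreal \<bar>\<nu> (A' i)\<bar>) \<le> (\<Sum>i. ennreal \<bar>\<nu> (A' i)\<bar>)"
    by (intro sum_le_suminf) auto
  moreover have "(\<Sum>i\<in>{0..<?n}. ennreal \<bar>\<nu> (A' i)\<bar>) = (\<Sum>i\<in>I. ennreal \<bar>\<nu> (A i)\<bar>)"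
    by (subst sum.reindex_bij_betw[OF h, symmetric]) (auto simp: A'_def)
  ultimately show ?thesis by order
qed

section \<open>The Jordan decomposition and integrals of indicators\<close>

definition upper_variation :: "'a measure \<Rightarrow> ('a set \<Rightarrow> real) \<Rightarrow> 'a set \<Rightarrow> ennreal" where
  "upper_variation M \<nu> E = (SUP B\<in>{B \<in> sets M. B \<subseteq> E}. ennreal (\<nu> B))"

lemma upper_variation_upper:
  "B \<in> sets M \<Longrightarrow> B \<subseteq> E \<Longrightarrow> ennreal (\<nu> B) \<le> upper_variation M \<nu> E"
  unfolding upper_variation_def by (intro SUP_upper) simp

lemma upper_variation_le_tv_norm: "upper_variation M \<nu> E \<le> tv_norm M \<nu>"
  unfolding upper_variation_def
proof (rule SUP_least)
  fix B assume "B \<in> {B \<in> sets M. B \<subseteq> E}"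
  then have B: "ennreal \<bar>\<nu> B\<bar> \<le> tv_norm M \<nu>"
    using sum_abs_le_tv_norm[of "{B}" "\<lambda>B. B" M \<nu>] by (simp add: disjoint_family_on_def)
  show "ennreal (\<nu> B) \<le> tv_norm M \<nu>"
    by (rule order_trans[OF ennreal_leI B]) simp
qed

text \<open>A subset of \<open>E\<close> and a subset of \<open>F\<close> combine to a subset of
  \<open>E \<union> F\<close> on which \<nu> takes the sum of the two values.\<close>

lemma upper_variation_superadditive:
  assumes \<nu>: "signed_measure M \<nu>" and disj: "E \<inter> F = {}"
  shows "upper_variation M \<nu> E + upper_variation M \<nu> F \<le> upper_variation M \<nu> (E \<union> F)"
proof -
  have ne: "{B \<in> sets M. B \<subseteq> E} \<noteq> {}" for E
    by blast
  have le: "ennreal (\<nu> B) + ennreal (\<nu> C) \<le> upper_variation M \<nu> (E \<union> F)"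
    if "B \<in> sets M" "B \<subseteq> E" "C \<in> sets M" "C \<subseteq> F" for B C
  proof -
    have U: "\<nu> (B \<union> C) = \<nu> B + \<nu> C"
      using that disj by (intro signed_measure_Un[OF \<nu>]) auto
    have B: "ennreal (\<nu> B) \<le> upper_variation M \<nu> (E \<union> F)"
      and C: "ennreal (\<nu> C) \<le> upper_variation M \<nu> (E \<union> F)"
      and BC: "ennreal (\<nu> B + \<nu> C) \<le> upper_variation M \<nu> (E \<union> F)"
      using that by (auto intro!: upper_variation_upper simp: U[symmetric])
    show ?thesis
    \<comment> \<open>\<open>ennreal\<close> truncates negative values to 0, so if one of the values
      is negative its term vanishes and the other set alone gives the bound.\<close>
    proof (cases "0 \<le> \<nu> B \<and> 0 \<le> \<nu> C")
      case True
      then show ?thesis using BC by simp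
    next
      case False
      then show ?thesis using B C by (auto simp: ennreal_neg not_le less_imp_le)
    qed
  qed
  show ?thesis
    unfolding upper_variation_def[of M \<nu> E] upper_variation_def[of M \<nu> F]
    by (subst ennreal_SUP_add_left[OF ne, symmetric], rule SUP_least,
        subst ennreal_SUP_add_right[OF ne], rule SUP_least)
      (auto intro: le)
qed

text \<open>One inequality follows from superadditivity on finite unions and monotonicity, the other
  by cutting a subset \<open>B\<close> of the union into the pieces
  \<open>A i \<inter> B\<close>.\<close>

lemma upper_variation_countably_additive:
  assumes \<nu>: "signed_measure M \<nu>"
  shows "countably_additive (sets M) (upper_variation M \<nu>)"
proof (rule countably_additiveI)
  fix A :: "nat \<Rightarrow> 'a set"
  assume A: "range A \<subseteq> sets M" "disjoint_family A"
  let ?p = "upper_variation M \<nu>"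
  have mono: "?p E \<le> ?p F" if "E \<subseteq> F" for E F
    unfolding upper_variation_def using that by (intro SUP_subset_mono) auto
  have "(\<Sum>i<n. ?p (A i)) \<le> ?p (\<Union>i<n. A i)" for n
  proof (induction n)
    case (Suc n)
    have "(\<Union>i<n. A i) \<inter> A n = {}"
    proof -
      have "A i \<inter> A n = {}" if "i < n" for i
        using disjoint_family_onD[OF A(2), of i n] that by simp
      then show ?thesis by auto
    qed
    from upper_variation_superadditive[OF \<nu> this] Suc
    have "(\<Sum>i<n. ?p (A i)) + ?p (A n) \<le> ?p ((\<Union>i<n. A i) \<union> A n)"
      by (meson add_right_mono order_trans)
    moreover have "(\<Union>i<n. A i) \<union> A n = (\<Union>i<Suc n. A i)"
      by (auto simp: less_Suc_eq)
    ultimately show ?case by simp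
  qed simp
  also have "?p (\<Union>i<n. A i) \<le> ?p (\<Union>i. A i)" for n
    by (rule mono) auto
  finally have 1: "(\<Sum>i. ?p (A i)) \<le> ?p (\<Union>i. A i)"
    by (intro suminf_le_const) auto
  have 2: "?p (\<Union>i. A i) \<le> (\<Sum>i. ?p (A i))"
  proof (subst upper_variation_def, rule SUP_least)
    fix B assume B: "B \<in> {B \<in> sets M. B \<subseteq> (\<Union>i. A i)}"
    have "range (\<lambda>i. A i \<inter> B) \<subseteq> sets M" "disjoint_family (\<lambda>i. A i \<inter> B)"
      using A B by (auto intro: disjoint_family_on_bisimulation)
    then have s: "(\<lambda>i. \<nu> (A i \<inter> B)) sums \<nu> (\<Union>i. A i \<inter> B)"
      using \<nu> unfolding signed_measure_def by blast
    have UB: "(\<Union>i. A i \<inter> B) = B"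
      using B by auto
    \<comment> \<open>The values on the pieces may be negative, so the two series are compared in
      the reals. This requires the right-hand series to be finite; otherwise the bound is
      trivial.\<close>
    show "ennreal (\<nu> B) \<le> (\<Sum>i. ?p (A i))"
    proof (cases "(\<Sum>i. ?p (A i)) = top")
      case False
      have fin: "?p (A i) \<noteq> top" for i
        using False ennreal_suminf_lessD[of "\<lambda>i. ?p (A i)" top] by (auto simp: less_top)
      then have eq: "?p (A i) = ennreal (enn2real (?p (A i)))" for i
        by (simp add: less_top)
      have summ: "summable (\<lambda>i. enn2real (?p (A i)))"
        using False eq by (intro summable_suminf_not_top) auto
      have "\<nu> (A i \<inter> B) \<le> enn2real (?p (A i))" for i
      proof -
        have "ennreal (\<nu> (A i \<inter> B)) \<le> ?p (A i)"
          using A B by (intro upper_variation_upper) auto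
        then show ?thesis
          using fin[of i] by (metis enn2real_nonneg eq ennreal_le_iff)
      qed
      then have "\<nu> B \<le> (\<Sum>i. enn2real (?p (A i)))"
        using sums_le[OF _ s summable_sums[OF summ]] by (simp only: UB)
      then have "ennreal (\<nu> B) \<le> ennreal (\<Sum>i. enn2real (?p (A i)))"
        by (rule ennreal_leI)
      also have "\<dots> = (\<Sum>i. ?p (A i))"
        by (subst suminf_ennreal2[symmetric, OF enn2real_nonneg summ]) (simp flip: eq)
      finally show ?thesis .
    qed simp
  qed
  from 1 2 show "(\<Sum>i. ?p (A i)) = ?p (\<Union>i. A i)"
    by (rule antisym)
qed

text \<open>Positivity and countable additivity are the conditions under which
  \<open>measure_of\<close> keeps the given set function.\<close>

lemma emeasure_pos_part:
  assumes "signed_measure M \<nu>" "E \<in> sets M"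
  shows "emeasure (pos_part M \<nu>) E = upper_variation M \<nu> E"
proof (rule emeasure_measure_of)
  show "pos_part M \<nu> = measure_of (space M) (sets M) (upper_variation M \<nu>)"
    unfolding pos_part_def upper_variation_def[abs_def] ..
  have "{B \<in> sets M. B \<subseteq> {}} = {{}}"
    by auto
  then have "upper_variation M \<nu> {} = 0"
    using assms(1) unfolding upper_variation_def signed_measure_def by auto
  then show "positive (sets (pos_part M \<nu>)) (upper_variation M \<nu>)"
    by (simp add: positive_def)
  show "countably_additive (sets (pos_part M \<nu>)) (upper_variation M \<nu>)"
    using upper_variation_countably_additive[OF assms(1)] by (simp add: pos_part_def)
qed (use assms(2) sets.space_closed in \<open>simp_all add: pos_part_def\<close>)

lemma sets_pos_part [simp]: "sets (pos_part M \<nu>) = sets M"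
  by (simp add: pos_part_def)

lemma space_pos_part [simp]: "space (pos_part M \<nu>) = space M"
  by (simp add: pos_part_def)

text \<open>For \<open>B \<subseteq> E\<close>, \<nu> takes on \<open>B\<close> its value on
  \<open>E\<close> minus its value on \<open>E - B\<close>, and the subtracted part is controlled by
  the upper variation of the negated measure. Finiteness matters since \<open>enn2real\<close> sends
  \<open>top\<close> to 0.\<close>

lemma upper_variation_le:
  assumes \<nu>: "signed_measure M \<nu>" and "E \<in> sets M" and fin: "tv_norm M \<nu> < top"
  shows "enn2real (upper_variation M \<nu> E) \<le> \<nu> E + enn2real (upper_variation M (\<lambda>A. - \<nu> A) E)"
proof -
  let ?n = "upper_variation M (\<lambda>A. - \<nu> A) E"
  have finn: "?n < top"
    using upper_variation_le_tv_norm[of M "\<lambda>A. - \<nu> A" E] fin by (simp add: tv_norm_uminus)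
  have le: "\<nu> B \<le> \<nu> E + enn2real ?n" if "B \<in> sets M" "B \<subseteq> E" for B
  proof -
    have "ennreal (- \<nu> (E - B)) \<le> ?n"
      using assms that by (intro upper_variation_upper) auto
    then have "- \<nu> (E - B) \<le> enn2real ?n"
      using finn by (metis enn2real_nonneg ennreal_enn2real ennreal_le_iff)
    moreover have "\<nu> (B \<union> (E - B)) = \<nu> B + \<nu> (E - B)"
      using assms that by (intro signed_measure_Un[OF \<nu>]) auto
    moreover have "B \<union> (E - B) = E"
      using that by blast
    ultimately show ?thesis by simp
  qed
  \<comment> \<open>The case \<open>B = {}\<close>; \<open>enn2real_leI\<close> asks for a
    nonnegative bound.\<close>
  have "0 \<le> \<nu> E + enn2real ?n"
    using le[of "{}"] \<nu> by (simp add: signed_measure_def)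
  moreover have "upper_variation M \<nu> E \<le> ennreal (\<nu> E + enn2real ?n)"
    unfolding upper_variation_def[of M \<nu>] by (intro SUP_least ennreal_leI) (auto intro: le)
  ultimately show ?thesis
    by (simp add: enn2real_leI)
qed

text \<open>The previous inequality, applied to \<nu> and to its negative, gives both
  directions.\<close>

lemma measure_pos_part_diff:
  assumes \<nu>: "signed_measure M \<nu>" and E: "E \<in> sets M" and fin: "tv_norm M \<nu> < top"
  shows "measure (pos_part M \<nu>) E - measure (neg_part M \<nu>) E = \<nu> E"
proof -
  have "enn2real (upper_variation M (\<lambda>A. - \<nu> A) E) \<le> - \<nu> E + enn2real (upper_variation M \<nu> E)"
    using upper_variation_le[OF signed_measure_uminus[OF \<nu>] E] fin by (simp add: tv_norm_uminus)
  then show ?thesis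
    using upper_variation_le[OF assms]
    by (simp add: measure_def neg_part_def emeasure_pos_part signed_measure_uminus \<nu> E)
qed

text \<open>Basis functions, as functions of the thresholds, are indicators on the threshold space,
  so this reduces all integrals of the extended class to values of the measure.\<close>

lemma signed_integral_indicator:
  assumes "signed_measure M \<nu>" "E \<in> sets M" "tv_norm M \<nu> < top"
    and g: "\<And>z. z \<in> space M \<Longrightarrow> g z = indicator E z"
  shows "signed_integral M \<nu> g = \<nu> E"
proof -
  have E: "E \<inter> space M = E"
    using assms(2) sets.sets_into_space by blast
  have "(\<integral>z. g z \<partial>pos_part M \<mu>) = measure (pos_part M \<mu>) E" for \<mu>
  proof -
    have "(\<integral>z. g z \<partial>pos_part M \<mu>) = (\<integral>z. indicator E z \<partial>pos_part M \<mu>)"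
      by (intro Bochner_Integration.integral_cong) (auto simp: g)
    then show ?thesis by (simp add: E)
  qed
  then show ?thesis
    using measure_pos_part_diff[OF assms(1-3)] by (simp add: signed_integral_def neg_part_def)
qed

section \<open>Point masses\<close>

lemma signed_measure_point_mass: "signed_measure M (\<lambda>A. w * indicator A z)"
  unfolding signed_measure_def
  by (auto intro!: sums_mult indicator_sums simp: disjoint_family_on_def)

text \<open>At most one member of a disjoint sequence contains \<open>z\<close>. Only an upper bound
  is claimed: \<open>z\<close> may lie outside the space, and then the norm is 0.\<close>

lemma tv_norm_point_mass_le: "tv_norm M (\<lambda>A. w * indicator A z) \<le> ennreal \<bar>w\<bar>"
  unfolding tv_norm_def variation_def
proof (rule SUP_least)
  fix A :: "nat \<Rightarrow> 'a set"
  assume A: "A \<in> {A. range A \<subseteq> sets M \<and> disjoint_family A \<and> (\<Union>i. A i) = space M}"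
  have s: "(\<lambda>i. \<bar>w\<bar> * indicator (A i) z) sums (\<bar>w\<bar> * indicator (\<Union>i. A i) z)"
    using A by (intro sums_mult indicator_sums) (auto simp: disjoint_family_on_def)
  have "(\<Sum>i. ennreal \<bar>w * indicator (A i) z\<bar>) = (\<Sum>i. ennreal (\<bar>w\<bar> * indicator (A i) z))"
    by (simp add: abs_mult)
  also have "\<dots> = ennreal (\<bar>w\<bar> * indicator (\<Union>i. A i) z)"
    using s by (subst suminf_ennreal2) (auto simp: sums_iff)
  also have "\<dots> \<le> ennreal \<bar>w\<bar>"
    by (intro ennreal_leI) (auto simp: indicator_def)
  finally show "(\<Sum>i. ennreal \<bar>w * indicator (A i) z\<bar>) \<le> ennreal \<bar>w\<bar>" .
qed


section \<open>Atoms of a finite family of sets\<close>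

text \<open>The atoms of the Boolean algebra generated by the sets \<open>B y\<close>, indexed by
  the set \<open>S\<close> of those \<open>y\<close> whose \<open>B y\<close> contains the point.
  Some of them may be empty.\<close>

definition atom_of :: "'a measure \<Rightarrow> ('b \<Rightarrow> 'a set) \<Rightarrow> 'b set \<Rightarrow> 'b set \<Rightarrow> 'a set" where
  "atom_of M B R S = {z \<in> space M. {y \<in> R. z \<in> B y} = S}"

lemma atom_of_sets:
  assumes "finite R" "\<And>y. y \<in> R \<Longrightarrow> B y \<in> sets M" "S \<subseteq> R"
  shows "atom_of M B R S \<in> sets M"
proof -
  have "atom_of M B R S = space M - ((\<Union>y\<in>R - S. B y) \<union> (\<Union>y\<in>S. space M - B y))"
    using assms(3) by (auto simp: atom_of_def)
  moreover have "(\<Union>y\<in>R - S. B y) \<union> (\<Union>y\<in>S. space M - B y) \<in> sets M"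
    using assms finite_subset[OF assms(3,1)]
    by (intro sets.Un sets.finite_UN sets.compl_sets) auto
  ultimately show ?thesis by auto
qed

lemma disjoint_family_atom_of: "disjoint_family_on (atom_of M B R) I"
  by (auto simp: disjoint_family_on_def atom_of_def)

text \<open>\<open>B y\<close> is the disjoint union of the atoms with \<open>y \<in> S\<close>. The
  factor \<open>of_bool\<close> makes the index set of the sum independent of
  \<open>y\<close>.\<close>

lemma signed_measure_eq_sum_atoms:
  assumes "signed_measure M \<nu>" "finite R" "\<And>y. y \<in> R \<Longrightarrow> B y \<in> sets M" "y \<in> R"
  shows "\<nu> (B y) = (\<Sum>S\<in>Pow R. \<nu> (atom_of M B R S) * of_bool (y \<in> S))"
proof -
  have "B y = (\<Union>S\<in>{S \<in> Pow R. y \<in> S}. atom_of M B R S)"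
  proof (intro equalityI subsetI)
    fix z assume z: "z \<in> B y"
    then have "z \<in> space M"
      using sets.sets_into_space[OF assms(3)[OF assms(4)]] by blast
    then have "z \<in> atom_of M B R {y \<in> R. z \<in> B y}"
      by (simp add: atom_of_def)
    moreover have "{y \<in> R. z \<in> B y} \<in> {S \<in> Pow R. y \<in> S}"
      using z assms(4) by simp
    ultimately show "z \<in> (\<Union>S\<in>{S \<in> Pow R. y \<in> S}. atom_of M B R S)"
      by (rule UN_I[rotated])
  next
    fix z assume "z \<in> (\<Union>S\<in>{S \<in> Pow R. y \<in> S}. atom_of M B R S)"
    then obtain S where "y \<in> S" "{y \<in> R. z \<in> B y} = S"
      by (auto simp: atom_of_def)
    then show "z \<in> B y" by blast
  qed
  also have "\<nu> \<dots> = (\<Sum>S\<in>{S \<in> Pow R. y \<in> S}. \<nu> (atom_of M B R S))"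
    using assms by (intro signed_measure_UN[OF assms(1)])
      (auto intro!: atom_of_sets disjoint_family_atom_of)
  also have "\<dots> = (\<Sum>S\<in>Pow R. \<nu> (atom_of M B R S) * of_bool (y \<in> S))"
    using assms(2) by (intro sum.mono_neutral_cong_left) auto
  finally show ?thesis .
qed


section \<open>Evaluation of the extended class\<close>

text \<open>The thresholds whose basis function is 1 at \<open>x\<close>. Extensional products are
  used because the points of a product measure space are extensional functions.\<close>

definition below :: "'d::finite set \<Rightarrow> 'd set \<Rightarrow> real ^ 'd \<Rightarrow> (('d \<Rightarrow> real) \<times> ('d \<Rightarrow> real)) set" where
  "below L U x = (\<Pi>\<^sub>E j\<in>L. {..x $ j}) \<times> (\<Pi>\<^sub>E j\<in>U. {x $ j<..})"

lemma below_sets: "below L U x \<in> sets (threshold_space L U)"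
  unfolding below_def threshold_space_def
  by (intro pair_measureI sets_PiM_I_finite) auto

lemma prod_of_bool:
  "finite A \<Longrightarrow> (\<Prod>j\<in>A. of_bool (P j) :: real) = of_bool (\<forall>j\<in>A. P j)"
  by (induction A rule: finite_induct) auto

lemma basis_fun_of_bool:
  "basis_fun L U l u x = of_bool ((\<forall>j\<in>L. l j \<le> x $ j) \<and> (\<forall>j\<in>U. x $ j < u j))"
  by (auto simp: basis_fun_def prod_of_bool)

lemma basis_fun_eq_indicator:
  assumes "(l, u) \<in> space (threshold_space L U)"
  shows "basis_fun L U l u x = indicator (below L U x) (l, u)"
  using assms unfolding basis_fun_of_bool below_def threshold_space_def
  by (auto simp: indicator_def space_pair_measure space_PiM PiE_iff)

text \<open>Removes integrals from the argument: only the values of the measures on the sets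
  \<open>below L U x\<close> remain, and these are visibly additive in the measure.\<close>

lemma inf_fun_eq:
  assumes "\<And>L U. (L, U) \<in> index_pairs s \<Longrightarrow> signed_measure (threshold_space L U) (\<nu> L U)"
    and "\<And>L U. (L, U) \<in> index_pairs s \<Longrightarrow> tv_norm (threshold_space L U) (\<nu> L U) < top"
  shows "inf_fun s c \<nu> x = c + (\<Sum>(L, U)\<in>index_pairs s. \<nu> L U (below L U x))"
  unfolding inf_fun_def
  using assms below_sets
  by (auto intro!: sum.cong signed_integral_indicator simp: basis_fun_eq_indicator)


section \<open>Coarsening to a finite grid\<close>

text \<open>\<open>Min T - 1\<close> stands for all points below the grid \<open>T\<close>.\<close>

definition coarsen :: "real set \<Rightarrow> real \<Rightarrow> real" where
  "coarsen T a = Max (insert (Min T - 1) (T \<inter> {..a}))"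

definition coarsen_vec :: "real set \<Rightarrow> real ^ 'd \<Rightarrow> real ^ 'd" where
  "coarsen_vec T x = (\<chi> j. coarsen T (x $ j))"

lemma le_coarsen_iff:
  "finite T \<Longrightarrow> l \<le> coarsen T a \<longleftrightarrow> l \<le> Min T - 1 \<or> (\<exists>t\<in>T. l \<le> t \<and> t \<le> a)"
  unfolding coarsen_def by (subst Max_ge_iff) auto

text \<open>The extra value \<open>Min T - 1\<close> is strictly below every grid point, so splits
  at grid points cannot tell a point from its coarsening.\<close>

lemma le_coarsen_iff_grid:
  assumes "finite T" "t \<in> T"
  shows "t \<le> coarsen T a \<longleftrightarrow> t \<le> a"
proof -
  have "\<not> t \<le> Min T - 1"
    using Min_le[OF assms] by linarith
  then show ?thesis
    using assms by (auto simp: le_coarsen_iff intro: order_trans)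
qed

text \<open>The superlevel sets of a monotone right-continuous step function are everything,
  nothing, or a closed right half-line, which is what one split can express.\<close>

lemma le_coarsen_cases:
  assumes "finite T"
  obtains "\<And>a. l \<le> coarsen T a" | "\<And>a. \<not> l \<le> coarsen T a"
    | t where "\<And>a. l \<le> coarsen T a \<longleftrightarrow> t \<le> a"
proof (cases "l \<le> Min T - 1 \<or> T \<inter> {l..} = {}")
  case True
  then show ?thesis using that(1,2) assms by (auto simp: le_coarsen_iff)
next
  case False
  \<comment> \<open>The jump occurs at the least grid point that is at least
    \<open>l\<close>.\<close>
  have "l \<le> coarsen T a \<longleftrightarrow> Min (T \<inter> {l..}) \<le> a" for a
    using assms False by (subst Min_le_iff) (auto simp: le_coarsen_iff)
  then show ?thesis by (rule that(3))
qed

lemma finite_range_coarsen_vec: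
  assumes "finite T"
  shows "finite (range (coarsen_vec T :: real ^ 'd::finite \<Rightarrow> _))"
proof -
  let ?G = "insert (Min T - 1) T"
  have "\<forall>a. coarsen T a \<in> ?G"
  proof
    show "coarsen T a \<in> ?G" for a
      using Max_in[of "insert (Min T - 1) (T \<inter> {..a})"] assms by (auto simp: coarsen_def)
  qed
  then have "vec_nth ` range (coarsen_vec T) \<subseteq> (\<Pi>\<^sub>E j\<in>(UNIV :: 'd set). ?G)"
    by (auto simp: coarsen_vec_def)
  moreover have "finite (\<Pi>\<^sub>E j\<in>(UNIV :: 'd set). ?G)"
    using assms by (intro finite_PiE) auto
  ultimately have "finite (vec_nth ` range (coarsen_vec T :: real ^ 'd \<Rightarrow> _))"
    by (rule finite_subset)
  then show ?thesis
    by (rule finite_imageD) (auto simp: inj_on_def vec_nth_inject)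
qed

fun thresholds :: "'d rtree \<Rightarrow> real set" where
  "thresholds (Leaf w) = {}"
| "thresholds (Split j t A B) = insert t (thresholds A \<union> thresholds B)"

lemma finite_thresholds [simp]: "finite (thresholds t)"
  by (induction t) auto

lemma tree_fun_coarsen_vec:
  "finite T \<Longrightarrow> thresholds t \<subseteq> T \<Longrightarrow> tree_fun t (coarsen_vec T x) = tree_fun t x"
  by (induction t) (auto simp: coarsen_vec_def le_coarsen_iff_grid)


section \<open>Coarsened basis functions are trees\<close>

abbreviation leaf_norm :: "'d rtree \<Rightarrow> real" where
  "leaf_norm t \<equiv> (\<Sum>w\<leftarrow>leaf_weights t. \<bar>w\<bar>)"

lemma leaf_norm_nonneg: "0 \<le> leaf_norm t"
  by (intro sum_list_nonneg) auto

lemma tree_penalty_le_leaf_norm: "tree_penalty t \<le> leaf_norm t"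
  by (cases t) (auto simp: tree_penalty_def)

text \<open>At most one new split is put above the tree, and its other branch is a leaf of weight 0,
  which leaves the norm unchanged.\<close>

lemma tree_times_lower_indicator:
  assumes "finite T"
  obtains t' where "tree_depth t' \<le> Suc (tree_depth t)" "leaf_norm t' \<le> leaf_norm t"
    "\<And>x. tree_fun t' x = of_bool (l \<le> coarsen T (x $ j)) * tree_fun t x"
proof (cases rule: le_coarsen_cases[OF assms, where l = l])
  case 1
  then show ?thesis using that[of t] by simp
next
  case 2
  then show ?thesis using that[of "Leaf 0"] leaf_norm_nonneg[of t] by simp
next
  case (3 r)
  then show ?thesis using that[of "Split j r t (Leaf 0)"] by simp
qed

lemma tree_times_upper_indicator:
  assumes "finite T"
  obtains t' where "tree_depth t' \<le> Suc (tree_depth t)" "leaf_norm t' \<le> leaf_norm t"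
    "\<And>x. tree_fun t' x = of_bool (coarsen T (x $ j) < u) * tree_fun t x"
proof (cases rule: le_coarsen_cases[OF assms, where l = u])
  \<comment> \<open>The upper indicator is the complement of the superlevel set at \<open>u\<close>,
    so compared with the lower indicator the first two cases, and the branches in the third, change
    places.\<close>
  case 1
  then show ?thesis using that[of "Leaf 0"] leaf_norm_nonneg[of t] by (simp add: not_less[symmetric])
next
  case 2
  then show ?thesis using that[of t] by (simp add: not_le)
next
  case (3 r)
  then have "coarsen T a < u \<longleftrightarrow> a < r" for a
    by (simp flip: not_le)
  then show ?thesis using that[of "Split j r (Leaf 0) t"] by (simp add: not_le)
qed

text \<open>Start from a single leaf of weight \<open>w\<close> and multiply by the indicators one
  at a time, first over \<open>L\<close>, then over \<open>U\<close>. Each factor adds at most one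
  level.\<close>

lemma coarsened_basis_fun_tree:
  fixes L U :: "'d::finite set"
  assumes T: "finite T"
  obtains t where "tree_depth t \<le> card L + card U" "leaf_norm t \<le> \<bar>w\<bar>"
    "\<And>x. tree_fun t x = w * basis_fun L U l u (coarsen_vec T x)"
proof -
  have "\<exists>t. tree_depth t \<le> card L \<and> leaf_norm t \<le> \<bar>w\<bar> \<and>
      (\<forall>x. tree_fun t x = w * basis_fun L {} l u (coarsen_vec T x))"
    using finite[of L]
  proof (induction L)
    case empty
    show ?case by (intro exI[of _ "Leaf w"]) (simp add: basis_fun_def)
  next
    case (insert j L)
    then obtain t where t: "tree_depth t \<le> card L" "leaf_norm t \<le> \<bar>w\<bar>"
      "\<And>x. tree_fun t x = w * basis_fun L {} l u (coarsen_vec T x)"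
      by blast
    obtain t' where "tree_depth t' \<le> Suc (tree_depth t)" "leaf_norm t' \<le> leaf_norm t"
      "\<And>x. tree_fun t' x = of_bool (l j \<le> coarsen T (x $ j)) * tree_fun t x"
      using tree_times_lower_indicator[OF T] by blast
    with t insert.hyps show ?case
      by (intro exI[of _ t']) (auto simp: basis_fun_def coarsen_vec_def)
  qed
  then obtain t0 where t0: "tree_depth t0 \<le> card L" "leaf_norm t0 \<le> \<bar>w\<bar>"
    "\<And>x. tree_fun t0 x = w * basis_fun L {} l u (coarsen_vec T x)"
    by blast
  have "\<exists>t. tree_depth t \<le> card L + card U \<and> leaf_norm t \<le> \<bar>w\<bar> \<and>
      (\<forall>x. tree_fun t x = w * basis_fun L U l u (coarsen_vec T x))"
    using finite[of U]
  proof (induction U)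
    case empty
    show ?case using t0 by auto
  next
    case (insert j U)
    then obtain t where t: "tree_depth t \<le> card L + card U" "leaf_norm t \<le> \<bar>w\<bar>"
      "\<And>x. tree_fun t x = w * basis_fun L U l u (coarsen_vec T x)"
      by blast
    obtain t' where "tree_depth t' \<le> Suc (tree_depth t)" "leaf_norm t' \<le> leaf_norm t"
      "\<And>x. tree_fun t' x = of_bool (coarsen T (x $ j) < u j) * tree_fun t x"
      using tree_times_upper_indicator[OF T] by blast
    with t insert.hyps show ?case
      by (intro exI[of _ t']) (auto simp: basis_fun_def coarsen_vec_def)
  qed
  then show ?thesis using that by blast
qed

section \<open>From measures to trees\<close>

lemma V_XGB_le_tv_norm:
  fixes f :: "real ^ 'd::finite \<Rightarrow> real"
  assumes "f \<in> F_ST s" and rep: "(c, \<nu>) \<in> inf_representations s f"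
  shows "V_XGB s f \<le> (\<Sum>(L, U)\<in>index_pairs s. tv_norm (threshold_space L U) (\<nu> L U))"
proof (cases "(\<Sum>(L, U)\<in>index_pairs s. tv_norm (threshold_space L U) (\<nu> L U)) = top")
  case False
  let ?I = "index_pairs s :: ('d set \<times> 'd set) set"
  have sm: "signed_measure (threshold_space L U) (\<nu> L U)" if "(L, U) \<in> ?I" for L U
    using rep that by (auto simp: inf_representations_def)
  have fin: "tv_norm (threshold_space L U) (\<nu> L U) < top" if "(L, U) \<in> ?I" for L U
    using False that by (auto simp: less_top)
  obtain Ts where Ts: "Ts \<in> tree_representations s f"
    using assms(1) by (auto simp: F_ST_def)
  define T where "T = (\<Union>t\<in>set Ts. thresholds t)"
  have T: "finite T"
    by (simp add: T_def)
  let ?q = "coarsen_vec T :: real ^ 'd \<Rightarrow> real ^ 'd"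
  define R where "R = range ?q"
  have R: "finite R"
    using finite_range_coarsen_vec[OF T] by (simp add: R_def)
  have fq: "f (?q x) = f x" for x
  proof -
    have "(\<Sum>t\<leftarrow>Ts. tree_fun t (?q x)) = (\<Sum>t\<leftarrow>Ts. tree_fun t x)"
      by (intro arg_cong[where f = sum_list] map_cong refl tree_fun_coarsen_vec[OF T]) (auto simp: T_def)
    then show ?thesis
      using Ts by (simp add: tree_representations_def)
  qed
  \<comment> \<open>Atoms of the finitely many sets \<open>below L U y\<close> with \<open>y\<close>
    in the range of the coarsening.\<close>
  define \<alpha> where "\<alpha> L U = atom_of (threshold_space L U) (below L U) R" for L U :: "'d set"
  have f_eq: "f x = c + (\<Sum>((L, U), S)\<in>?I \<times> Pow R. \<nu> L U (\<alpha> L U S) * of_bool (?q x \<in> S))" for x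
  proof -
    have "f x = inf_fun s c \<nu> (?q x)"
      using rep fq by (auto simp: inf_representations_def)
    also have "\<dots> = c + (\<Sum>(L, U)\<in>?I. \<nu> L U (below L U (?q x)))"
      by (intro inf_fun_eq sm fin)
    also have "(\<Sum>(L, U)\<in>?I. \<nu> L U (below L U (?q x))) =
        (\<Sum>(L, U)\<in>?I. \<Sum>S\<in>Pow R. \<nu> L U (\<alpha> L U S) * of_bool (?q x \<in> S))"
      unfolding \<alpha>_def
      by (intro sum.cong refl)
        (auto intro!: signed_measure_eq_sum_atoms sm below_sets R, simp add: R_def)
    also have "\<dots> = (\<Sum>((L, U), S)\<in>?I \<times> Pow R. \<nu> L U (\<alpha> L U S) * of_bool (?q x \<in> S))"
      by (subst sum.cartesian_product[symmetric]) (simp add: case_prod_beta)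
    finally show ?thesis .
  qed
  have "\<exists>t. tree_depth t \<le> s \<and> leaf_norm t \<le> \<bar>\<nu> L U (\<alpha> L U S)\<bar> \<and>
      (\<forall>x. tree_fun t x = \<nu> L U (\<alpha> L U S) * of_bool (?q x \<in> S))" if LU: "(L, U) \<in> ?I" for L U S
  \<comment> \<open>An empty atom has measure 0. A nonempty one supplies thresholds
    \<open>l\<close>, \<open>u\<close>, and membership in the atom says that their basis function is
    1 on \<open>S\<close> and 0 on the rest of \<open>R\<close>.\<close>
  proof (cases "\<alpha> L U S = {}")
    case True
    then show ?thesis
      using sm[OF LU] by (intro exI[of _ "Leaf 0"]) (simp add: signed_measure_def)
  next
    case False
    then obtain l u where lu: "(l, u) \<in> \<alpha> L U S" by auto
    then have "basis_fun L U l u (?q x) = of_bool (?q x \<in> S)" for x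
      by (auto simp: basis_fun_eq_indicator \<alpha>_def atom_of_def R_def indicator_def)
    moreover obtain t where "tree_depth t \<le> card L + card U" "leaf_norm t \<le> \<bar>\<nu> L U (\<alpha> L U S)\<bar>"
      "\<And>x. tree_fun t x = \<nu> L U (\<alpha> L U S) * basis_fun L U l u (?q x)"
      using coarsened_basis_fun_tree[OF T, of L U "\<nu> L U (\<alpha> L U S)" l u] by blast
    moreover have "card L + card U \<le> s"
      using LU by (simp add: index_pairs_def)
    ultimately show ?thesis
      by (intro exI[of _ t]) simp
  qed
  then have "\<forall>L U S. \<exists>t. (L, U) \<in> ?I \<longrightarrow> tree_depth t \<le> s \<and> leaf_norm t \<le> \<bar>\<nu> L U (\<alpha> L U S)\<bar> \<and>
      (\<forall>x. tree_fun t x = \<nu> L U (\<alpha> L U S) * of_bool (?q x \<in> S))"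
    by blast
  then obtain t where "\<forall>L U S. (L, U) \<in> ?I \<longrightarrow>
      tree_depth (t L U S) \<le> s \<and> leaf_norm (t L U S) \<le> \<bar>\<nu> L U (\<alpha> L U S)\<bar> \<and>
      (\<forall>x. tree_fun (t L U S) x = \<nu> L U (\<alpha> L U S) * of_bool (?q x \<in> S))"
    unfolding choice_iff by blast
  then have t: "tree_depth (t L U S) \<le> s" "leaf_norm (t L U S) \<le> \<bar>\<nu> L U (\<alpha> L U S)\<bar>"
    "tree_fun (t L U S) x = \<nu> L U (\<alpha> L U S) * of_bool (?q x \<in> S)"
    if "(L, U) \<in> ?I" for L U S x
    using that by blast+
  obtain xs where xs: "set xs = ?I \<times> Pow R" "distinct xs"
    using finite_distinct_list[of "?I \<times> Pow R"] R by auto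
  have list_sum: "(\<Sum>i\<leftarrow>xs. g i) = (\<Sum>i\<in>?I \<times> Pow R. g i)" for g :: "_ \<Rightarrow> real"
    using xs by (simp add: sum_list_distinct_conv_sum_set)
  let ?t = "\<lambda>((L, U), S). t L U S"
  \<comment> \<open>The constant becomes a tree without splits, which is not penalized and keeps the
    list nonempty.\<close>
  let ?Ts = "Leaf c # map ?t xs"
  have "f x = (\<Sum>t\<leftarrow>?Ts. tree_fun t x)" for x
    unfolding f_eq by (simp add: list_sum o_def) (auto intro!: sum.cong simp: t)
  moreover have "\<forall>t\<in>set ?Ts. tree_depth t \<le> s"
    using t(1) xs(1) by auto
  ultimately have "?Ts \<in> tree_representations s f"
    by (simp add: tree_representations_def)
  then have "V_XGB s f \<le> ennreal (\<Sum>t\<leftarrow>?Ts. tree_penalty t)"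
    unfolding V_XGB_def by (rule INF_lower)
  also have "(\<Sum>t\<leftarrow>?Ts. tree_penalty t) = (\<Sum>i\<in>?I \<times> Pow R. tree_penalty (?t i))"
    by (simp add: list_sum o_def tree_penalty_def[of "Leaf c"])
  also have "\<dots> \<le> (\<Sum>((L, U), S)\<in>?I \<times> Pow R. \<bar>\<nu> L U (\<alpha> L U S)\<bar>)"
    using t(2) by (intro sum_mono) (auto intro: order_trans[OF tree_penalty_le_leaf_norm])
  also have "\<dots> = (\<Sum>(L, U)\<in>?I. \<Sum>S\<in>Pow R. \<bar>\<nu> L U (\<alpha> L U S)\<bar>)"
    by (subst sum.cartesian_product[symmetric]) (simp add: case_prod_beta)
  also have "ennreal \<dots> = (\<Sum>(L, U)\<in>?I. \<Sum>S\<in>Pow R. ennreal \<bar>\<nu> L U (\<alpha> L U S)\<bar>)"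
    by (subst sum_ennreal[symmetric]) (auto intro!: sum_nonneg sum.cong simp: sum_ennreal)
  also have "\<dots> \<le> (\<Sum>(L, U)\<in>?I. tv_norm (threshold_space L U) (\<nu> L U))"
    unfolding \<alpha>_def
    by (intro sum_mono) (auto intro!: sum_abs_le_tv_norm atom_of_sets disjoint_family_atom_of
      below_sets R simp del: sum_ennreal)
  finally show ?thesis
    by (simp add: ennreal_leI)
qed (simp only: top_greatest)


section \<open>Trees as discrete measures\<close>

text \<open>A bound on \<open>V_inf_XGB\<close> with an explicit witness, suited to induction over
  trees. As \<open>v\<close> is real, the witness has finite total variation, so
  \<open>inf_fun_eq\<close> applies to it.\<close>

definition tv_attains :: "nat \<Rightarrow> (real ^ 'd::finite \<Rightarrow> real) \<Rightarrow> real \<Rightarrow> bool" where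
  "tv_attains s f v \<longleftrightarrow> 0 \<le> v \<and> (\<exists>(c, \<nu>)\<in>inf_representations s f.
     (\<Sum>(L, U)\<in>index_pairs s. tv_norm (threshold_space L U) (\<nu> L U)) \<le> ennreal v)"

text \<open>Measures are added pointwise. Jordan parts are not additive, so the functions are
  compared through \<open>inf_fun_eq\<close>.\<close>

lemma tv_attains_add:
  fixes f g :: "real ^ 'd::finite \<Rightarrow> real"
  assumes "tv_attains s f v" "tv_attains s g w"
  shows "tv_attains s (\<lambda>x. f x + g x) (v + w)"
proof -
  let ?I = "index_pairs s :: ('d set \<times> 'd set) set"
  let ?tv = "\<lambda>\<nu> (L, U). tv_norm (threshold_space L U) (\<nu> L U)"
  obtain c \<nu> where \<nu>: "(c, \<nu>) \<in> inf_representations s f" "sum (?tv \<nu>) ?I \<le> ennreal v"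
    using assms(1) unfolding tv_attains_def by blast
  obtain d \<mu> where \<mu>: "(d, \<mu>) \<in> inf_representations s g" "sum (?tv \<mu>) ?I \<le> ennreal w"
    using assms(2) unfolding tv_attains_def by blast
  define \<rho> where "\<rho> L U A = \<nu> L U A + \<mu> L U A" for L U A
  have "sum (?tv \<rho>) ?I \<le> sum (?tv \<nu>) ?I + sum (?tv \<mu>) ?I"
    unfolding \<rho>_def sum.distrib[symmetric] by (intro sum_mono) (auto intro: tv_norm_add_le)
  also have "\<dots> \<le> ennreal (v + w)"
    using \<nu>(2) \<mu>(2) assms by (simp add: tv_attains_def add_mono)
  finally have le: "sum (?tv \<rho>) ?I \<le> ennreal (v + w)" .
  have fin: "tv_norm (threshold_space L U) (\<kappa> L U) < top"
    if "sum (?tv \<kappa>) ?I \<le> ennreal r" "(L, U) \<in> ?I" for \<kappa> r L U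
  proof -
    have "sum (?tv \<kappa>) ?I < top"
      using that(1) by (rule le_less_trans) simp
    then show ?thesis
      using that(2) by (auto simp: less_top)
  qed
  have sm: "signed_measure (threshold_space L U) (\<nu> L U)"
    "signed_measure (threshold_space L U) (\<mu> L U)"
    "signed_measure (threshold_space L U) (\<rho> L U)" if "(L, U) \<in> ?I" for L U
    using \<nu>(1) \<mu>(1) that unfolding \<rho>_def
    by (auto simp: inf_representations_def intro!: signed_measure_add)
  have "inf_fun s (c + d) \<rho> x = inf_fun s c \<nu> x + inf_fun s d \<mu> x" for x
    using sm fin[OF \<nu>(2)] fin[OF \<mu>(2)] fin[OF le]
    by (simp add: inf_fun_eq \<rho>_def case_prod_beta sum.distrib)
  then have "(c + d, \<rho>) \<in> inf_representations s (\<lambda>x. f x + g x)"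
    using \<nu>(1) \<mu>(1) sm(3) by (auto simp: inf_representations_def)
  then show ?thesis
    using le assms unfolding tv_attains_def by auto
qed

lemma tv_attains_const: "tv_attains s (\<lambda>_ :: real ^ 'd::finite. c) 0"
proof -
  define \<nu> :: "'d measure_family" where "\<nu> = (\<lambda>L U A. 0)"
  have tv: "tv_norm M (\<lambda>_. 0) = 0" and sm: "signed_measure M (\<lambda>_. 0)" for M :: "'z measure"
    using tv_norm_point_mass_le[of M 0] signed_measure_point_mass[of M 0] by simp_all
  have "(c, \<nu>) \<in> inf_representations s (\<lambda>_. c)"
    using inf_fun_eq[of s \<nu> c] by (auto simp: inf_representations_def \<nu>_def tv sm)
  then show ?thesis
    by (force simp: tv_attains_def \<nu>_def tv)
qed

lemma tv_attains_basis_fun: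
  fixes L U :: "'d::finite set"
  assumes "(L, U) \<in> index_pairs s"
  shows "tv_attains s (\<lambda>x. w * basis_fun L U l u x) \<bar>w\<bar>"
proof -
  let ?I = "index_pairs s :: ('d set \<times> 'd set) set"
  \<comment> \<open>Restriction makes the thresholds extensional, as membership in
    \<open>below\<close> demands.\<close>
  define z where "z = (restrict l L, restrict u U)"
  define v where "v L' U' = (if (L', U') = (L, U) then w else 0)" for L' U'
  define \<nu> :: "'d measure_family" where "\<nu> L' U' = (\<lambda>A. v L' U' * indicator A z)" for L' U'
  have sm: "signed_measure (threshold_space L' U') (\<nu> L' U')" for L' U'
    unfolding \<nu>_def by (rule signed_measure_point_mass)
  have tv: "tv_norm (threshold_space L' U') (\<nu> L' U') \<le> ennreal \<bar>v L' U'\<bar>" for L' U'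
    unfolding \<nu>_def by (rule tv_norm_point_mass_le)
  have "(\<Sum>(L', U')\<in>?I. tv_norm (threshold_space L' U') (\<nu> L' U'))
      \<le> (\<Sum>(L', U')\<in>?I. ennreal \<bar>v L' U'\<bar>)"
    using tv by (intro sum_mono) auto
  also have "\<dots> = (\<Sum>p\<in>?I. if p = (L, U) then ennreal \<bar>w\<bar> else 0)"
    by (intro sum.cong refl) (simp add: v_def split: prod.split)
  also have "\<dots> = ennreal \<bar>w\<bar>"
    using assms by simp
  finally have le: "(\<Sum>(L', U')\<in>?I. tv_norm (threshold_space L' U') (\<nu> L' U')) \<le> ennreal \<bar>w\<bar>" .
  have "inf_fun s 0 \<nu> x = w * basis_fun L U l u x" for x
  proof -
    have "inf_fun s 0 \<nu> x = 0 + (\<Sum>(L', U')\<in>?I. \<nu> L' U' (below L' U' x))"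
      using sm le_less_trans[OF tv] by (intro inf_fun_eq) auto
    also have "\<dots> = (\<Sum>p\<in>?I. if p = (L, U) then w * indicator (below L U x) z else 0)"
      by (subst add_0_left, intro sum.cong refl) (simp add: v_def \<nu>_def split: prod.split)
    also have "\<dots> = w * indicator (below L U x) z"
      using assms by simp
    also have "indicator (below L U x) z = basis_fun L U l u x"
      by (auto simp: z_def below_def basis_fun_of_bool indicator_def PiE_iff)
    finally show ?thesis .
  qed
  then have "(0, \<nu>) \<in> inf_representations s (\<lambda>x. w * basis_fun L U l u x)"
    using sm by (auto simp: inf_representations_def)
  then show ?thesis
    using le by (auto simp: tv_attains_def)
qed

text \<open>A repeated split on the same side of coordinate \<open>j\<close> merges with the old
  threshold by \<open>max\<close>, so the number of factors need not grow.\<close>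

lemma basis_fun_times_lower_indicator:
  obtains L' l' where "card L' \<le> Suc (card L)" "0 < card L'"
    "\<And>x. basis_fun L' U l' u x = basis_fun L U l u x * of_bool (t \<le> x $ j)"
proof (rule that[of "insert j L" "l(j := if j \<in> L then max (l j) t else t)"])
  show "basis_fun (insert j L) U (l(j := if j \<in> L then max (l j) t else t)) u x =
      basis_fun L U l u x * of_bool (t \<le> x $ j)" for x
    by (auto simp: basis_fun_of_bool split: if_splits)
qed (auto simp: card_insert_if card_gt_0_iff)

lemma basis_fun_times_upper_indicator:
  obtains U' u' where "card U' \<le> Suc (card U)" "0 < card U'"
    "\<And>x. basis_fun L U' l u' x = basis_fun L U l u x * of_bool (x $ j < t)"
proof (rule that[of "insert j U" "u(j := if j \<in> U then min (u j) t else t)"])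
  show "basis_fun L (insert j U) l (u(j := if j \<in> U then min (u j) t else t)) x =
      basis_fun L U l u x * of_bool (x $ j < t)" for x
    by (auto simp: basis_fun_of_bool split: if_splits)
qed (auto simp: card_insert_if card_gt_0_iff)

text \<open>The basis function records the path from the root to the current subtree. The second
  assumption ensures that at a leaf the path is nonempty, so that the pair lies in
  \<open>index_pairs s\<close>.\<close>

lemma tv_attains_basis_fun_times_tree:
  assumes "card L + card U + tree_depth t \<le> s" "0 < card L + card U \<or> 0 < tree_depth t"
  shows "tv_attains s (\<lambda>x. basis_fun L U l u x * tree_fun t x) (leaf_norm t)"
  using assms
proof (induction t arbitrary: L U l u)
  case (Leaf w)
  then show ?case
    using tv_attains_basis_fun[of L U s w l u] by (simp add: index_pairs_def mult.commute)
next
  case (Split j r A B)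
  obtain L' l' where L': "card L' \<le> Suc (card L)" "0 < card L'"
    "\<And>x. basis_fun L' U l' u x = basis_fun L U l u x * of_bool (r \<le> x $ j)"
    using basis_fun_times_lower_indicator by blast
  obtain U' u' where U': "card U' \<le> Suc (card U)" "0 < card U'"
    "\<And>x. basis_fun L U' l u' x = basis_fun L U l u x * of_bool (x $ j < r)"
    using basis_fun_times_upper_indicator by blast
  have "tv_attains s (\<lambda>x. basis_fun L' U l' u x * tree_fun A x) (leaf_norm A)"
    using Split.prems L' by (intro Split.IH) auto
  moreover have "tv_attains s (\<lambda>x. basis_fun L U' l u' x * tree_fun B x) (leaf_norm B)"
    using Split.prems U' by (intro Split.IH) auto
  ultimately have "tv_attains s (\<lambda>x. basis_fun L' U l' u x * tree_fun A x +
      basis_fun L U' l u' x * tree_fun B x) (leaf_norm A + leaf_norm B)"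
    by (rule tv_attains_add)
  moreover have "basis_fun L' U l' u x * tree_fun A x + basis_fun L U' l u' x * tree_fun B x =
      basis_fun L U l u x * tree_fun (Split j r A B) x" for x
    by (simp add: L' U')
  ultimately show ?case by simp
qed

text \<open>A constant tree goes into \<open>c\<close> at no cost, in accordance with its zero
  penalty; any other tree starts from the empty path.\<close>

lemma tv_attains_tree:
  assumes "tree_depth t \<le> s"
  shows "tv_attains s (tree_fun t) (tree_penalty t)"
proof (cases t)
  case (Leaf w)
  then have "tree_fun t = (\<lambda>_. w)" by auto
  with Leaf show ?thesis
    using tv_attains_const[of s w] by (simp add: tree_penalty_def)
next
  case (Split j r A B)
  have "(\<lambda>x. basis_fun {} {} l u x * tree_fun t x) = tree_fun t" for l u
    by (simp add: basis_fun_def)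
  moreover have "leaf_norm t = tree_penalty t"
    by (simp add: Split tree_penalty_def)
  ultimately show ?thesis
    using tv_attains_basis_fun_times_tree[of "{}" "{}" t s] assms Split by simp
qed

lemma tv_attains_sum_trees:
  assumes "\<And>t. t \<in> set Ts \<Longrightarrow> tree_depth t \<le> s"
  shows "tv_attains s (\<lambda>x. \<Sum>t\<leftarrow>Ts. tree_fun t x) (\<Sum>t\<leftarrow>Ts. tree_penalty t)"
  using assms
proof (induction Ts)
  case Nil
  show ?case using tv_attains_const[of s 0] by simp
next
  case (Cons t Ts)
  then show ?case
    using tv_attains_add[OF tv_attains_tree[of t s]] by simp
qed

theorem theorem1:
  fixes s :: nat and f :: "real ^ 'd::finite \<Rightarrow> real"
  assumes "s \<ge> 1" and "f \<in> F_ST s"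
  shows "V_inf_XGB s f = V_XGB s f"
proof (rule antisym)
  show "V_XGB s f \<le> V_inf_XGB s f"
    unfolding V_inf_XGB_def using V_XGB_le_tv_norm[OF assms(2)] by (intro INF_greatest) auto
  show "V_inf_XGB s f \<le> V_XGB s f"
    unfolding V_XGB_def
  proof (rule INF_greatest)
    fix Ts assume "Ts \<in> tree_representations s f"
    then have "tv_attains s (\<lambda>x. \<Sum>t\<leftarrow>Ts. tree_fun t x) (\<Sum>t\<leftarrow>Ts. tree_penalty t)"
      and "(\<lambda>x. \<Sum>t\<leftarrow>Ts. tree_fun t x) = f"
      by (auto simp: tree_representations_def intro!: tv_attains_sum_trees)
    then show "V_inf_XGB s f \<le> ennreal (\<Sum>t\<leftarrow>Ts. tree_penalty t)"
      unfolding V_inf_XGB_def tv_attains_def by (auto intro: INF_lower2)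
  qed
qed

end
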